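(* Let $R$ be a ring. Then the left $R$-module ${}_R R$ is g-radical supplemented if and only if every finitely generated left $R$-module is g-radical supplemented.
   Context: All rings are associative with identity and all modules are unital left modules; ${}_R R$ is $R$ regarded as a left module over itself. $N \le M$ means $N$ is a submodule of $M$. A submodule $N \le M$ is essential if $K \cap N \ne 0$ for every nonzero submodule $K$ of $M$. The generalized radical $Rad_g M$ of a module $M$ is the intersection of all maximal submodules of $M$ that are essential in $M$; if $M$ has no such submodule, $Rad_g M = M$. For $U, V \le M$, $V$ is a g-radical supplement of $U$ in $M$ if $M = U + V$ and $U \cap V \le Rad_g V$. The module $M$ is g-radical supplemented if every submodule of $M$ has a g-radical supplement in $M$. *)

theory Defs
  imports "HOL-Algebra.Module" "HOL-Algebra.AbelCoset"
begin

text \<open>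
  The locale \<^locale>\<open>module\<close> demands a commutative ring of scalars. The locale below has the
  same axioms over an arbitrary ring with identity. The record \<^typ>\<open>('a, 'b) module\<close> and the
  predicate \<^const>\<open>submodule\<close> do not involve commutativity and are reused; the fields
  \<^const>\<open>mult\<close> and \<^const>\<open>one\<close> of a module record carry no meaning.
\<close>

locale left_module = R?: ring R + M?: abelian_group M
  for R (structure) and M (structure) +
  assumes smult_closed:
      "\<lbrakk>a \<in> carrier R; x \<in> carrier M\<rbrakk> \<Longrightarrow> a \<odot>\<^bsub>M\<^esub> x \<in> carrier M"
    and smult_l_distr:
      "\<lbrakk>a \<in> carrier R; b \<in> carrier R; x \<in> carrier M\<rbrakk> \<Longrightarrow>
        (a \<oplus> b) \<odot>\<^bsub>M\<^esub> x = (a \<odot>\<^bsub>M\<^esub> x) \<oplus>\<^bsub>M\<^esub> (b \<odot>\<^bsub>M\<^esub> x)"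
    and smult_r_distr:
      "\<lbrakk>a \<in> carrier R; x \<in> carrier M; y \<in> carrier M\<rbrakk> \<Longrightarrow>
        a \<odot>\<^bsub>M\<^esub> (x \<oplus>\<^bsub>M\<^esub> y) = (a \<odot>\<^bsub>M\<^esub> x) \<oplus>\<^bsub>M\<^esub> (a \<odot>\<^bsub>M\<^esub> y)"
    and smult_assoc:
      "\<lbrakk>a \<in> carrier R; b \<in> carrier R; x \<in> carrier M\<rbrakk> \<Longrightarrow>
        (a \<otimes> b) \<odot>\<^bsub>M\<^esub> x = a \<odot>\<^bsub>M\<^esub> (b \<odot>\<^bsub>M\<^esub> x)"
    and smult_one: "x \<in> carrier M \<Longrightarrow> \<one> \<odot>\<^bsub>M\<^esub> x = x"

lemma left_module_iff_module:
  assumes "cring R"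
  shows "left_module R M \<longleftrightarrow> module R M"
proof -
  have "left_module_axioms R M \<longleftrightarrow> module_axioms R M"
    by (simp only: left_module_axioms_def module_axioms_def)
  then show ?thesis
    using assms cring.axioms(1)[OF assms] by (simp add: left_module_def module_def)
qed

definition regular_module :: "('a, 'r) ring_scheme \<Rightarrow> ('a, 'a) module" where
  "regular_module R =
    \<lparr>carrier = carrier R, mult = mult R, one = one R, zero = zero R, add = add R, smult = mult R\<rparr>"

lemma (in ring) left_module_regular_module: "left_module R (regular_module R)"
proof -
  have "\<exists>y\<in>carrier R. y \<oplus> x = \<zero>" if "x \<in> carrier R" for x
    using that l_neg by blast
  then have "abelian_group (regular_module R)"
    by (intro abelian_groupI) (simp_all add: regular_module_def a_ac)
  then show ?thesis
    by (intro left_module.intro left_module_axioms.intro ring_axioms)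
      (simp_all add: regular_module_def l_distr r_distr m_assoc)
qed

text \<open>
  In all definitions below, a submodule \<open>V\<close> of \<open>M\<close> is regarded as a module in its own right
  by restricting the carrier, that is, as \<open>M\<lparr>carrier := V\<rparr>\<close>.
\<close>

lemma (in left_module) left_module_submodule:
  assumes "submodule V R M"
  shows "left_module R (M\<lparr>carrier := V\<rparr>)"
proof -
  interpret V: submodule V R M by fact
  have V: "x \<in> carrier M" if "x \<in> V" for x using V.subset that by auto
  have inv: "\<exists>y\<in>V. x \<oplus>\<^bsub>M\<^esub> y = \<zero>\<^bsub>M\<^esub>" if "x \<in> V" for x
    using V.m_inv_closed[OF that] M.r_neg[OF V[OF that]] by (auto simp: a_inv_def)
  have closed: "x \<oplus>\<^bsub>M\<^esub> y \<in> V" if "x \<in> V" "y \<in> V" for x y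
    using V.m_closed[OF that] by simp
  have zero: "\<zero>\<^bsub>M\<^esub> \<in> V"
    using V.one_closed by simp
  have "abelian_group (M\<lparr>carrier := V\<rparr>)"
    by (intro abelian_groupI) (simp_all add: closed zero inv V M.a_ac)
  then show ?thesis
    by (intro left_module.intro left_module_axioms.intro R.ring_axioms)
      (simp_all add: V smult_l_distr smult_r_distr smult_assoc smult_one)
qed

definition generated_submodule ::
    "('a, 'r) ring_scheme \<Rightarrow> ('a, 'm, 'z) module_scheme \<Rightarrow> 'm set \<Rightarrow> 'm set" where
  "generated_submodule R M S = \<Inter>{N. submodule N R M \<and> S \<subseteq> N}"

definition finitely_generated ::
    "('a, 'r) ring_scheme \<Rightarrow> ('a, 'm, 'z) module_scheme \<Rightarrow> bool" where
  "finitely_generated R M \<longleftrightarrow>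
    (\<exists>S. finite S \<and> S \<subseteq> carrier M \<and> generated_submodule R M S = carrier M)"

definition maximal_submodule ::
    "'m set \<Rightarrow> ('a, 'r) ring_scheme \<Rightarrow> ('a, 'm, 'z) module_scheme \<Rightarrow> bool" where
  "maximal_submodule N R M \<longleftrightarrow>
    submodule N R M \<and> N \<noteq> carrier M \<and>
    (\<forall>K. submodule K R M \<and> N \<subseteq> K \<longrightarrow> K = N \<or> K = carrier M)"

definition essential_submodule ::
    "'m set \<Rightarrow> ('a, 'r) ring_scheme \<Rightarrow> ('a, 'm, 'z) module_scheme \<Rightarrow> bool" where
  "essential_submodule N R M \<longleftrightarrow>
    submodule N R M \<and>
    (\<forall>K. submodule K R M \<and> K \<noteq> {\<zero>\<^bsub>M\<^esub>} \<longrightarrow> K \<inter> N \<noteq> {\<zero>\<^bsub>M\<^esub>})"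

definition Rad_g ::
    "('a, 'r) ring_scheme \<Rightarrow> ('a, 'm, 'z) module_scheme \<Rightarrow> 'm set" where
  "Rad_g R M =
    (if \<exists>N. maximal_submodule N R M \<and> essential_submodule N R M
     then \<Inter>{N. maximal_submodule N R M \<and> essential_submodule N R M}
     else carrier M)"

definition g_radical_supplement ::
    "'m set \<Rightarrow> 'm set \<Rightarrow> ('a, 'r) ring_scheme \<Rightarrow> ('a, 'm, 'z) module_scheme \<Rightarrow> bool" where
  \<comment> \<open>\<open>V\<close> is a g-radical supplement of \<open>U\<close> in \<open>M\<close>\<close>
  "g_radical_supplement V U R M \<longleftrightarrow>
    submodule U R M \<and> submodule V R M \<and>
    carrier M = U <+>\<^bsub>M\<^esub> V \<and> U \<inter> V \<subseteq> Rad_g R (M\<lparr>carrier := V\<rparr>)"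

definition g_radical_supplemented ::
    "('a, 'r) ring_scheme \<Rightarrow> ('a, 'm, 'z) module_scheme \<Rightarrow> bool" where
  "g_radical_supplemented R M \<longleftrightarrow>
    (\<forall>U. submodule U R M \<longrightarrow> (\<exists>V. g_radical_supplement V U R M))"

end

theory Submission
  imports Defs
begin

text \<open>
  A module homomorphism \<open>f\<close> pulls a maximal essential submodule back either to the whole module or
  to a maximal essential submodule, so it maps generalized radicals into generalized radicals.
  Hence g-radical supplemented modules are closed under homomorphic images; in particular all
  cyclic modules \<open>Rx\<close> inherit the property from \<open>R\<close>. If \<open>N \<le> M\<close> is g-radical supplemented, a
  g-radical supplement \<open>X\<close> of \<open>N + U\<close> in \<open>M\<close> and a g-radical supplement \<open>Y\<close> of
  \<open>(U + X) \<inter> N\<close> in \<open>N\<close> yield the g-radical supplement \<open>X + Y\<close> of \<open>U\<close> in \<open>M\<close>. Adding the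
  generators of \<open>M\<close> to \<open>U\<close> one by one thus reduces the supplement of \<open>U\<close> to that of \<open>M\<close> itself,
  which is \<open>0\<close>.
\<close>

section \<open>Submodules over an arbitrary ring, and membership in the generalized radical\<close>

context left_module
begin

lemma smult_zero_left: "x \<in> carrier M \<Longrightarrow> \<zero> \<odot>\<^bsub>M\<^esub> x = \<zero>\<^bsub>M\<^esub>"
  using smult_l_distr[of \<zero> \<zero> x] smult_closed[of \<zero> x]
  by (metis M.add.r_cancel_one' R.l_zero R.zero_closed)

lemma smult_minus_one: "x \<in> carrier M \<Longrightarrow> (\<ominus> \<one>) \<odot>\<^bsub>M\<^esub> x = \<ominus>\<^bsub>M\<^esub> x"
  using smult_l_distr[of "\<ominus> \<one>" \<one> x] smult_zero_left[of x]
  by (simp add: R.l_neg smult_one smult_closed M.minus_equality)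

text \<open>Negatives are multiples by \<open>\<ominus> \<one>\<close>, so closure under scalars
  yields the inverses that \<open>subgroup\<close> asks for. Later submodule proofs go through this
  elementwise form.\<close>

lemma submodule_iff:
  "submodule H R M \<longleftrightarrow> H \<subseteq> carrier M \<and> \<zero>\<^bsub>M\<^esub> \<in> H \<and> (\<forall>x\<in>H. \<forall>y\<in>H. x \<oplus>\<^bsub>M\<^esub> y \<in> H)
    \<and> (\<forall>a\<in>carrier R. \<forall>x\<in>H. a \<odot>\<^bsub>M\<^esub> x \<in> H)" (is "?L \<longleftrightarrow> ?R")
proof
  assume ?L
  then interpret H: submodule H R M .
  show ?R
    using H.subset H.m_closed H.one_closed H.smult_closed by auto
next
  assume H: ?R
  have "inv\<^bsub>add_monoid M\<^esub> x \<in> H" if "x \<in> H" for x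
  proof -
    have "(\<ominus> \<one>) \<odot>\<^bsub>M\<^esub> x \<in> H"
      using H that by auto
    then show ?thesis
      using smult_minus_one[of x] H that by (metis a_inv_def subsetD)
  qed
  then show ?L
    using H by (intro submodule.intro subgroup.intro submodule_axioms.intro) auto
qed

lemma submodule_subset: "submodule H R M \<Longrightarrow> H \<subseteq> carrier M"
  by (simp add: submodule_iff)

lemma submodule_zero: "submodule H R M \<Longrightarrow> \<zero>\<^bsub>M\<^esub> \<in> H"
  by (simp add: submodule_iff)

lemma submodule_add: "submodule H R M \<Longrightarrow> x \<in> H \<Longrightarrow> y \<in> H \<Longrightarrow> x \<oplus>\<^bsub>M\<^esub> y \<in> H"
  by (simp add: submodule_iff)

lemma submodule_smult: "submodule H R M \<Longrightarrow> a \<in> carrier R \<Longrightarrow> x \<in> H \<Longrightarrow> a \<odot>\<^bsub>M\<^esub> x \<in> H"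
  by (simp add: submodule_iff)

lemma submodule_a_inv: "submodule H R M \<Longrightarrow> x \<in> H \<Longrightarrow> \<ominus>\<^bsub>M\<^esub> x \<in> H"
  by (metis R.a_inv_closed R.one_closed smult_minus_one submodule_smult submodule_subset subsetD)

lemma submodule_carrier: "submodule (carrier M) R M"
  by (simp add: submodule_iff smult_closed)

lemma submodule_singleton_zero: "submodule {\<zero>\<^bsub>M\<^esub>} R M"
proof -
  have "a \<odot>\<^bsub>M\<^esub> \<zero>\<^bsub>M\<^esub> = \<zero>\<^bsub>M\<^esub>" if "a \<in> carrier R" for a
    using that smult_r_distr[of a "\<zero>\<^bsub>M\<^esub>" "\<zero>\<^bsub>M\<^esub>"] smult_closed[of a "\<zero>\<^bsub>M\<^esub>"]
    by (metis M.add.r_cancel_one' M.l_zero M.zero_closed)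
  then show ?thesis
    by (simp add: submodule_iff)
qed

lemma submodule_Int: "submodule H R M \<Longrightarrow> submodule K R M \<Longrightarrow> submodule (H \<inter> K) R M"
  by (auto simp: submodule_iff)

lemma submodule_set_add:
  assumes H: "submodule H R M" and K: "submodule K R M"
  shows "submodule (H <+>\<^bsub>M\<^esub> K) R M"
proof -
  have c: "x \<in> carrier M" if "x \<in> H \<or> x \<in> K" for x
    using that submodule_subset[OF H] submodule_subset[OF K] by auto
  have z: "\<exists>x\<in>H. \<exists>y\<in>K. \<zero>\<^bsub>M\<^esub> = x \<oplus>\<^bsub>M\<^esub> y"
    using submodule_zero[OF H] submodule_zero[OF K] by (metis M.l_zero M.zero_closed)
  have a: "\<exists>x\<in>H. \<exists>y\<in>K. (h \<oplus>\<^bsub>M\<^esub> k) \<oplus>\<^bsub>M\<^esub> (h' \<oplus>\<^bsub>M\<^esub> k') = x \<oplus>\<^bsub>M\<^esub> y"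
    if "h \<in> H" "k \<in> K" "h' \<in> H" "k' \<in> K" for h k h' k'
  proof (intro bexI)
    show "(h \<oplus>\<^bsub>M\<^esub> k) \<oplus>\<^bsub>M\<^esub> (h' \<oplus>\<^bsub>M\<^esub> k') = (h \<oplus>\<^bsub>M\<^esub> h') \<oplus>\<^bsub>M\<^esub> (k \<oplus>\<^bsub>M\<^esub> k')"
      using that c by (simp add: M.a_ac)
  qed (use that submodule_add[OF H] submodule_add[OF K] in auto)
  have s: "\<exists>x\<in>H. \<exists>y\<in>K. a \<odot>\<^bsub>M\<^esub> (h \<oplus>\<^bsub>M\<^esub> k) = x \<oplus>\<^bsub>M\<^esub> y"
    if "a \<in> carrier R" "h \<in> H" "k \<in> K" for a h k
    using that c smult_r_distr[of a h k] submodule_smult[OF H] submodule_smult[OF K] by blast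
  show ?thesis
    unfolding submodule_iff set_add_def' using c z a s by auto
qed

lemma subset_set_add:
  assumes H: "submodule H R M" and K: "submodule K R M"
  shows "H \<subseteq> H <+>\<^bsub>M\<^esub> K" "K \<subseteq> H <+>\<^bsub>M\<^esub> K"
proof -
  have "x = x \<oplus>\<^bsub>M\<^esub> \<zero>\<^bsub>M\<^esub> \<and> x = \<zero>\<^bsub>M\<^esub> \<oplus>\<^bsub>M\<^esub> x" if "x \<in> H \<or> x \<in> K" for x
    using that submodule_subset[OF H] submodule_subset[OF K] by auto
  then show "H \<subseteq> H <+>\<^bsub>M\<^esub> K" "K \<subseteq> H <+>\<^bsub>M\<^esub> K"
    unfolding set_add_def' using submodule_zero[OF H] submodule_zero[OF K] by blast+
qed

text \<open>Restriction changes only the carrier, so the closure conditions are the same. Submodules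
  of N can thus be handled as submodules of M.\<close>

lemma submodule_restrict_iff:
  assumes N: "submodule N R M"
  shows "submodule H R (M\<lparr>carrier := N\<rparr>) \<longleftrightarrow> submodule H R M \<and> H \<subseteq> N"
proof -
  interpret N: left_module R "M\<lparr>carrier := N\<rparr>"
    by (rule left_module_submodule[OF N])
  show ?thesis
    using submodule_subset[OF N] by (auto simp: N.submodule_iff submodule_iff)
qed

text \<open>Merges both branches of \<open>Rad_g_def\<close>: if no maximal essential submodule
  exists, the second conjunct is vacuous and the carrier condition is the default value.\<close>

lemma mem_Rad_g_iff:
  "x \<in> Rad_g R M \<longleftrightarrow>
    x \<in> carrier M \<and> (\<forall>N. maximal_submodule N R M \<and> essential_submodule N R M \<longrightarrow> x \<in> N)"
  using submodule_subset by (auto simp: Rad_g_def maximal_submodule_def)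

lemma Rad_g_add: "x \<in> Rad_g R M \<Longrightarrow> y \<in> Rad_g R M \<Longrightarrow> x \<oplus>\<^bsub>M\<^esub> y \<in> Rad_g R M"
  by (auto simp: mem_Rad_g_iff essential_submodule_def intro: submodule_add)

end

section \<open>Homomorphisms, preimages and the generalized radical\<close>

locale left_module_hom = M: left_module R M + N: left_module R N
  for R and M and N and f +
  assumes hom_closed: "x \<in> carrier M \<Longrightarrow> f x \<in> carrier N"
    and hom_add: "x \<in> carrier M \<Longrightarrow> y \<in> carrier M \<Longrightarrow> f (x \<oplus>\<^bsub>M\<^esub> y) = f x \<oplus>\<^bsub>N\<^esub> f y"
    and hom_smult: "a \<in> carrier R \<Longrightarrow> x \<in> carrier M \<Longrightarrow> f (a \<odot>\<^bsub>M\<^esub> x) = a \<odot>\<^bsub>N\<^esub> f x"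
begin

lemma hom_zero: "f \<zero>\<^bsub>M\<^esub> = \<zero>\<^bsub>N\<^esub>"
  using hom_smult[of "\<zero>\<^bsub>R\<^esub>" "\<zero>\<^bsub>M\<^esub>"] by (simp add: M.smult_zero_left N.smult_zero_left hom_closed)

lemma hom_a_inv: "x \<in> carrier M \<Longrightarrow> f (\<ominus>\<^bsub>M\<^esub> x) = \<ominus>\<^bsub>N\<^esub> f x"
  using hom_smult[of "\<ominus>\<^bsub>R\<^esub> \<one>\<^bsub>R\<^esub>" x] by (simp add: M.smult_minus_one N.smult_minus_one hom_closed)

lemma submodule_vimage:
  assumes K: "submodule K R N"
  shows "submodule {x \<in> carrier M. f x \<in> K} R M"
  using N.submodule_zero[OF K] N.submodule_add[OF K] N.submodule_smult[OF K]
  by (auto simp: M.submodule_iff hom_zero hom_add hom_smult M.smult_closed)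

lemma submodule_image:
  assumes K: "submodule K R M"
  shows "submodule (f ` K) R N"
proof -
  have c: "x \<in> carrier M" if "x \<in> K" for x
    using that M.submodule_subset[OF K] by auto
  have "f x \<oplus>\<^bsub>N\<^esub> f y \<in> f ` K" if "x \<in> K" "y \<in> K" for x y
    using that c M.submodule_add[OF K] by (metis hom_add imageI)
  moreover have "a \<odot>\<^bsub>N\<^esub> f x \<in> f ` K" if "a \<in> carrier R" "x \<in> K" for a x
    using that c M.submodule_smult[OF K] by (metis hom_smult imageI)
  moreover have "\<zero>\<^bsub>N\<^esub> \<in> f ` K"
    using M.submodule_zero[OF K] by (metis hom_zero imageI)
  ultimately show ?thesis
    using c by (auto simp: N.submodule_iff hom_closed)
qed

text \<open>Let L be nonzero. If f kills L, then L lies inside the preimage. Otherwise f(L) is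
  nonzero and meets K in some nonzero f x with x in L, and this x is a nonzero element of the
  intersection.\<close>

lemma essential_submodule_vimage:
  assumes K: "essential_submodule K R N"
  shows "essential_submodule {x \<in> carrier M. f x \<in> K} R M"
  unfolding essential_submodule_def
proof (intro conjI allI impI)
  have sub: "submodule K R N"
    using K by (simp add: essential_submodule_def)
  show "submodule {x \<in> carrier M. f x \<in> K} R M"
    by (rule submodule_vimage[OF sub])
  fix L assume L: "submodule L R M \<and> L \<noteq> {\<zero>\<^bsub>M\<^esub>}"
  have c: "x \<in> carrier M" if "x \<in> L" for x
    using that L M.submodule_subset by auto
  show "L \<inter> {x \<in> carrier M. f x \<in> K} \<noteq> {\<zero>\<^bsub>M\<^esub>}"
  proof (cases "f ` L = {\<zero>\<^bsub>N\<^esub>}")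
    case True
    then have "f x \<in> K" if "x \<in> L" for x
      using that N.submodule_zero[OF sub] by (metis imageI singletonD)
    then have "L \<inter> {x \<in> carrier M. f x \<in> K} = L"
      using c by auto
    then show ?thesis
      using L by simp
  next
    case False
    then have "f ` L \<inter> K \<noteq> {\<zero>\<^bsub>N\<^esub>}"
      using K L submodule_image by (simp add: essential_submodule_def)
    \<comment> \<open>Being different from the zero submodule yields a nonzero element only once the
      empty set is excluded.\<close>
    moreover have "\<zero>\<^bsub>N\<^esub> \<in> f ` L \<inter> K"
      using L N.submodule_zero submodule_image sub by blast
    ultimately obtain x where x: "x \<in> L" "f x \<in> K" "f x \<noteq> \<zero>\<^bsub>N\<^esub>"
      by blast
    then have "x \<in> L \<inter> {x \<in> carrier M. f x \<in> K}" "x \<noteq> \<zero>\<^bsub>M\<^esub>"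
      using c by (auto simp: hom_zero)
    then show ?thesis
      by (metis singletonD)
  qed
qed

text \<open>If L properly contains the preimage, maximality of K forces f(L) + K = N. Each m in M
  then has f m = f l + k with l in L and k in K, so m - l lies in the preimage, hence in L, and m
  lies in L. Assumption \<open>ne\<close> excludes the case that f maps M into K.\<close>

lemma maximal_submodule_vimage:
  assumes K: "maximal_submodule K R N" and ne: "{x \<in> carrier M. f x \<in> K} \<noteq> carrier M"
  shows "maximal_submodule {x \<in> carrier M. f x \<in> K} R M"
  unfolding maximal_submodule_def
proof (intro conjI allI impI)
  let ?P = "{x \<in> carrier M. f x \<in> K}"
  have sub: "submodule K R N"
    using K by (simp add: maximal_submodule_def)
  show "submodule ?P R M"
    by (rule submodule_vimage[OF sub])
  show "?P \<noteq> carrier M"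
    by (rule ne)
  fix L assume L: "submodule L R M \<and> ?P \<subseteq> L"
  then have subL: "submodule L R M"
    by simp
  have c: "x \<in> carrier M" if "x \<in> L" for x
    using that M.submodule_subset[OF subL] by auto
  show "L = ?P \<or> L = carrier M"
  proof (cases "L = ?P")
    case False
    then obtain x where x: "x \<in> L" "f x \<notin> K"
      using L c by blast
    have "submodule (f ` L <+>\<^bsub>N\<^esub> K) R N" "f ` L \<subseteq> f ` L <+>\<^bsub>N\<^esub> K" "K \<subseteq> f ` L <+>\<^bsub>N\<^esub> K"
      using N.submodule_set_add N.subset_set_add submodule_image[OF subL] sub by blast+
    \<comment> \<open>The sum contains K and also f x, which is outside K.\<close>
    then have sum: "f ` L <+>\<^bsub>N\<^esub> K = carrier N"
      using K x unfolding maximal_submodule_def by blast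
    have "m \<in> L" if m: "m \<in> carrier M" for m
    proof -
      obtain l k where l: "l \<in> L" "k \<in> K" "f m = f l \<oplus>\<^bsub>N\<^esub> k"
        using hom_closed[OF m] unfolding sum[symmetric] set_add_def' by blast
      have kc: "k \<in> carrier N"
        using l N.submodule_subset[OF sub] by blast
      have "f (\<ominus>\<^bsub>M\<^esub> l \<oplus>\<^bsub>M\<^esub> m) = \<ominus>\<^bsub>N\<^esub> f l \<oplus>\<^bsub>N\<^esub> (f l \<oplus>\<^bsub>N\<^esub> k)"
        using m l c by (simp add: hom_add hom_a_inv)
      also have "\<dots> = k"
        using l c kc by (simp add: hom_closed N.M.r_neg1)
      finally have "\<ominus>\<^bsub>M\<^esub> l \<oplus>\<^bsub>M\<^esub> m \<in> L"
        using L l m c by auto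
      then have "l \<oplus>\<^bsub>M\<^esub> (\<ominus>\<^bsub>M\<^esub> l \<oplus>\<^bsub>M\<^esub> m) \<in> L"
        using M.submodule_add[OF subL] l by blast
      then show ?thesis
        using l m c by (simp add: M.M.r_neg2)
    qed
    then show ?thesis
      using c by blast
  qed simp
qed

text \<open>The preimage of a maximal essential K is all of M or again maximal and essential; x lies
  in it either way. Since f is arbitrary, this covers inclusions as well as surjections.\<close>

lemma hom_Rad_g:
  assumes x: "x \<in> Rad_g R M"
  shows "f x \<in> Rad_g R N"
proof -
  have "f x \<in> K" if "maximal_submodule K R N" "essential_submodule K R N" for K
    using x maximal_submodule_vimage[OF that(1)] essential_submodule_vimage[OF that(2)]
    unfolding M.mem_Rad_g_iff by blast
  then show ?thesis
    using x hom_closed by (simp add: M.mem_Rad_g_iff N.mem_Rad_g_iff)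
qed

lemma left_module_hom_restrict:
  assumes V: "submodule V R M" and W: "submodule W R N" and "f ` V \<subseteq> W"
  shows "left_module_hom R (M\<lparr>carrier := V\<rparr>) (N\<lparr>carrier := W\<rparr>) f"
  using assms M.submodule_subset[OF V]
  by (intro left_module_hom.intro left_module_hom_axioms.intro M.left_module_submodule
      N.left_module_submodule) (auto simp: hom_add hom_smult subset_iff)

text \<open>If V is a supplement of the preimage of U, then f(V) is one of U: a point of U \<inter>
  f(V) is f v with v in V and in the preimage, so v is in the radical of V, and f carries it into
  the radical of f(V).\<close>

lemma g_radical_supplemented_image:
  assumes surj: "f ` carrier M = carrier N" and M: "g_radical_supplemented R M"
  shows "g_radical_supplemented R N"
  unfolding g_radical_supplemented_def
proof (intro allI impI)
  fix U assume U: "submodule U R N"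
  let ?P = "{x \<in> carrier M. f x \<in> U}"
  obtain V where V: "submodule V R M" "carrier M = ?P <+>\<^bsub>M\<^esub> V"
    "?P \<inter> V \<subseteq> Rad_g R (M\<lparr>carrier := V\<rparr>)"
    using M submodule_vimage[OF U]
    unfolding g_radical_supplemented_def g_radical_supplement_def by blast
  have c: "x \<in> carrier M" if "x \<in> V" for x
    using that M.submodule_subset[OF V(1)] by auto
  note fV = submodule_image[OF V(1)]
  have "left_module_hom R (M\<lparr>carrier := V\<rparr>) (N\<lparr>carrier := f ` V\<rparr>) f"
    by (rule left_module_hom_restrict[OF V(1) fV subset_refl])
  note Rad_V = left_module_hom.hom_Rad_g[OF this]
  have "n \<in> U <+>\<^bsub>N\<^esub> f ` V" if "n \<in> carrier N" for n
  proof -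
    obtain m where m: "m \<in> carrier M" "n = f m"
      using \<open>n \<in> carrier N\<close> surj by blast
    have "m \<in> ?P <+>\<^bsub>M\<^esub> V"
      by (rule subsetD[OF equalityD1[OF V(2)] m(1)])
    then obtain p v where pv: "p \<in> ?P" "v \<in> V" "m = p \<oplus>\<^bsub>M\<^esub> v"
      unfolding set_add_def' by blast
    then have "n = f p \<oplus>\<^bsub>N\<^esub> f v"
      using c by (simp add: m(2) hom_add)
    then show ?thesis
      using pv unfolding set_add_def' by blast
  qed
  moreover have "U <+>\<^bsub>N\<^esub> f ` V \<subseteq> carrier N"
    using N.submodule_subset[OF N.submodule_set_add[OF U fV]] .
  moreover have "U \<inter> f ` V \<subseteq> Rad_g R (N\<lparr>carrier := f ` V\<rparr>)"
    using V(3) c Rad_V by blast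
  ultimately have "g_radical_supplement (f ` V) U R N"
    using U fV by (auto simp: g_radical_supplement_def)
  then show "\<exists>V. g_radical_supplement V U R N" ..
qed

end

section \<open>Supplements of U from supplements of N + U\<close>

context left_module
begin

text \<open>The inclusion of H in K is a homomorphism, so \<open>hom_Rad_g\<close> applies.\<close>

lemma Rad_g_mono:
  assumes H: "submodule H R M" and K: "submodule K R M" and "H \<subseteq> K"
  shows "Rad_g R (M\<lparr>carrier := H\<rparr>) \<subseteq> Rad_g R (M\<lparr>carrier := K\<rparr>)"
proof -
  interpret id: left_module_hom R M M "\<lambda>x. x"
    by (intro left_module_hom.intro left_module_hom_axioms.intro left_module_axioms refl)
  have "left_module_hom R (M\<lparr>carrier := H\<rparr>) (M\<lparr>carrier := K\<rparr>) (\<lambda>x. x)"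
    using assms by (intro id.left_module_hom_restrict) auto
  from left_module_hom.hom_Rad_g[OF this] show ?thesis
    by blast
qed

text \<open>Since N = W + Y with W inside U + X, the sum N + U + X = M collapses to U + X + Y. If v
  = x + y lies in U, solving for x and for y puts each summand into the intersection controlled by
  its own supplement.\<close>

lemma g_radical_supplement_of_sum:
  assumes N: "submodule N R M" and supp: "g_radical_supplemented R (M\<lparr>carrier := N\<rparr>)"
    and U: "submodule U R M" and X: "g_radical_supplement X (N <+>\<^bsub>M\<^esub> U) R M"
  shows "\<exists>V. g_radical_supplement V U R M"
proof -
  have X: "submodule X R M" "carrier M = (N <+>\<^bsub>M\<^esub> U) <+>\<^bsub>M\<^esub> X"
    "(N <+>\<^bsub>M\<^esub> U) \<inter> X \<subseteq> Rad_g R (M\<lparr>carrier := X\<rparr>)"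
    using X by (auto simp: g_radical_supplement_def)
  let ?W = "(U <+>\<^bsub>M\<^esub> X) \<inter> N"
  have "submodule ?W R (M\<lparr>carrier := N\<rparr>)"
    using submodule_Int[OF submodule_set_add[OF U X(1)] N] by (simp add: submodule_restrict_iff[OF N])
  \<comment> \<open>The sum of W and Y in the restricted module is the same set as in M;
    \<open>set_add_def'\<close> makes this visible.\<close>
  then obtain Y where Y: "submodule Y R M" "Y \<subseteq> N" "N = ?W <+>\<^bsub>M\<^esub> Y"
    "?W \<inter> Y \<subseteq> Rad_g R (M\<lparr>carrier := Y\<rparr>)"
    using supp
    unfolding g_radical_supplemented_def g_radical_supplement_def submodule_restrict_iff[OF N]
    by (auto simp: set_add_def')
  let ?V = "X <+>\<^bsub>M\<^esub> Y"
  have V: "submodule ?V R M"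
    by (rule submodule_set_add[OF X(1) Y(1)])
  interpret V: left_module R "M\<lparr>carrier := ?V\<rparr>"
    by (rule left_module_submodule[OF V])
  have c: "x \<in> carrier M" if "x \<in> N \<or> x \<in> U \<or> x \<in> X \<or> x \<in> Y" for x
    using that submodule_subset[OF N] submodule_subset[OF U] submodule_subset[OF X(1)] Y(2) by auto
  have "m \<in> U <+>\<^bsub>M\<^esub> ?V" if "m \<in> carrier M" for m
  proof -
    obtain n u x where n: "n \<in> N" "u \<in> U" "x \<in> X" "m = (n \<oplus>\<^bsub>M\<^esub> u) \<oplus>\<^bsub>M\<^esub> x"
      using \<open>m \<in> carrier M\<close> unfolding X(2) set_add_def' by blast
    obtain w y where w: "w \<in> ?W" "y \<in> Y" "n = w \<oplus>\<^bsub>M\<^esub> y"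
      using n(1) Y(3) unfolding set_add_def' by blast
    obtain u' x' where u': "u' \<in> U" "x' \<in> X" "w = u' \<oplus>\<^bsub>M\<^esub> x'"
      using w(1) unfolding set_add_def' by blast
    have "m = (u' \<oplus>\<^bsub>M\<^esub> u) \<oplus>\<^bsub>M\<^esub> ((x' \<oplus>\<^bsub>M\<^esub> x) \<oplus>\<^bsub>M\<^esub> y)"
      using n w(2,3) u' c by (simp add: M.a_ac)
    moreover have "u' \<oplus>\<^bsub>M\<^esub> u \<in> U" "x' \<oplus>\<^bsub>M\<^esub> x \<in> X"
      using n u' submodule_add U X(1) by auto
    ultimately show ?thesis
      using w(2) unfolding set_add_def' by blast
  qed
  moreover have "U <+>\<^bsub>M\<^esub> ?V \<subseteq> carrier M"
    using submodule_subset[OF submodule_set_add[OF U V]] .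
  moreover have "U \<inter> ?V \<subseteq> Rad_g R (M\<lparr>carrier := ?V\<rparr>)"
  proof
    fix v assume "v \<in> U \<inter> ?V"
    then obtain x y where v: "v \<in> U" "x \<in> X" "y \<in> Y" "v = x \<oplus>\<^bsub>M\<^esub> y"
      unfolding set_add_def' by blast
    \<comment> \<open>As y lies in N and v in U, this puts x into N + U.\<close>
    have "x = \<ominus>\<^bsub>M\<^esub> y \<oplus>\<^bsub>M\<^esub> v"
      using v(2,3) c by (simp add: v(4) M.a_comm[of x y] M.r_neg1)
    moreover have "\<ominus>\<^bsub>M\<^esub> y \<in> N"
      using v Y(1,2) submodule_a_inv by blast
    ultimately have "x \<in> (N <+>\<^bsub>M\<^esub> U) \<inter> X"
      using v unfolding set_add_def' by blast
    then have x: "x \<in> Rad_g R (M\<lparr>carrier := ?V\<rparr>)"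
      using X(3) Rad_g_mono[OF X(1) V subset_set_add(1)[OF X(1) Y(1)]] by blast
    \<comment> \<open>As v lies in U and x in X, this puts y into U + X; also y is in Y, hence in
      N.\<close>
    have "y = v \<oplus>\<^bsub>M\<^esub> \<ominus>\<^bsub>M\<^esub> x"
      using v(2,3) c by (simp add: v(4) M.a_comm[of _ "\<ominus>\<^bsub>M\<^esub> x"] M.r_neg1)
    moreover have "\<ominus>\<^bsub>M\<^esub> x \<in> X"
      using v X(1) submodule_a_inv by blast
    ultimately have "y \<in> ?W \<inter> Y"
      using v Y(2) unfolding set_add_def' by blast
    then have "y \<in> Rad_g R (M\<lparr>carrier := ?V\<rparr>)"
      using Y(4) Rad_g_mono[OF Y(1) V subset_set_add(2)[OF X(1) Y(1)]] by blast
    then show "v \<in> Rad_g R (M\<lparr>carrier := ?V\<rparr>)"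
      using x V.Rad_g_add[of x y] v(4) by simp
  qed
  ultimately have "g_radical_supplement ?V U R M"
    using U V by (auto simp: g_radical_supplement_def)
  then show ?thesis ..
qed

section \<open>Cyclic submodules and induction on the generators\<close>

lemma left_module_hom_regular_module:
  assumes x: "x \<in> carrier M"
  shows "left_module_hom R (regular_module R) M (\<lambda>a. a \<odot>\<^bsub>M\<^esub> x)"
  using x by (intro left_module_hom.intro left_module_hom_axioms.intro left_module_axioms
      R.left_module_regular_module)
    (auto simp: regular_module_def smult_closed smult_l_distr smult_assoc)

text \<open>Rx is the image of the regular module under the homomorphism sending a to ax, so
  \<open>g_radical_supplemented_image\<close> applies.\<close>

lemma cyclic_submodule:
  assumes x: "x \<in> carrier M"
  shows "submodule ((\<lambda>a. a \<odot>\<^bsub>M\<^esub> x) ` carrier R) R M"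
    and "x \<in> (\<lambda>a. a \<odot>\<^bsub>M\<^esub> x) ` carrier R"
    and "g_radical_supplemented R (regular_module R) \<Longrightarrow>
      g_radical_supplemented R (M\<lparr>carrier := (\<lambda>a. a \<odot>\<^bsub>M\<^esub> x) ` carrier R\<rparr>)"
proof -
  let ?f = "\<lambda>a. a \<odot>\<^bsub>M\<^esub> x" and ?C = "(\<lambda>a. a \<odot>\<^bsub>M\<^esub> x) ` carrier R"
  have carr: "carrier (regular_module R) = carrier R"
    by (simp add: regular_module_def)
  interpret f: left_module_hom R "regular_module R" M ?f
    by (rule left_module_hom_regular_module[OF x])
  show C: "submodule ?C R M"
    using f.submodule_image[OF f.M.submodule_carrier] by (simp add: carr)
  show "x \<in> ?C"
    using smult_one[OF x] by (metis R.one_closed imageI)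
  \<comment> \<open>Restricting the source to its own carrier leaves the record unchanged, so only
    the target really shrinks.\<close>
  have "left_module_hom R ((regular_module R)\<lparr>carrier := carrier (regular_module R)\<rparr>)
    (M\<lparr>carrier := ?C\<rparr>) ?f"
    by (rule f.left_module_hom_restrict[OF f.M.submodule_carrier C]) (simp add: carr)
  then have g: "left_module_hom R (regular_module R) (M\<lparr>carrier := ?C\<rparr>) ?f"
    by simp
  show "g_radical_supplemented R (M\<lparr>carrier := ?C\<rparr>)"
    if "g_radical_supplemented R (regular_module R)"
    using left_module_hom.g_radical_supplemented_image[OF g _ that] by (simp add: carr)
qed

text \<open>Base case of the induction. Zero lies in every submodule, hence in the radical of the
  zero module.\<close>

lemma g_radical_supplement_carrier: "g_radical_supplement {\<zero>\<^bsub>M\<^esub>} (carrier M) R M"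
proof -
  interpret Z: left_module R "M\<lparr>carrier := {\<zero>\<^bsub>M\<^esub>}\<rparr>"
    by (rule left_module_submodule[OF submodule_singleton_zero])
  have "\<zero>\<^bsub>M\<^esub> \<in> Rad_g R (M\<lparr>carrier := {\<zero>\<^bsub>M\<^esub>}\<rparr>)"
    using Z.submodule_zero by (auto simp: Z.mem_Rad_g_iff maximal_submodule_def)
  moreover have "carrier M <+>\<^bsub>M\<^esub> {\<zero>\<^bsub>M\<^esub>} = carrier M"
    by (auto simp: set_add_def')
  ultimately show ?thesis
    by (simp add: g_radical_supplement_def submodule_carrier submodule_singleton_zero)
qed

text \<open>The last assumption says that S and U together generate M. The induction keeps this
  while moving generators from S into U, so U must be arbitrary; once S is empty, U is all of
  M.\<close>

lemma ex_g_radical_supplement: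
  assumes reg: "g_radical_supplemented R (regular_module R)"
    and "finite S" "S \<subseteq> carrier M" "submodule U R M"
    and "\<And>H. submodule H R M \<Longrightarrow> S \<union> U \<subseteq> H \<Longrightarrow> H = carrier M"
  shows "\<exists>V. g_radical_supplement V U R M"
  using assms(2-)
proof (induction S arbitrary: U rule: finite_induct)
  case empty
  then have "U = carrier M"
    by simp
  then show ?case
    using g_radical_supplement_carrier by blast
next
  case (insert x S)
  let ?C = "(\<lambda>a. a \<odot>\<^bsub>M\<^esub> x) ` carrier R"
  have x: "x \<in> carrier M"
    using insert.prems by simp
  note C = cyclic_submodule[OF x]
  note CU = subset_set_add[OF C(1) insert.prems(2)]
  have "\<exists>X. g_radical_supplement X (?C <+>\<^bsub>M\<^esub> U) R M"
  proof (rule insert.IH)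
    \<comment> \<open>Such an H contains x, which lies in Rx, and U, so it contains all the original
      generators.\<close>
    show "H = carrier M" if "submodule H R M" "S \<union> (?C <+>\<^bsub>M\<^esub> U) \<subseteq> H" for H
      using that C(2) CU by (intro insert.prems(3)) auto
  qed (use insert.prems C(1) submodule_set_add in auto)
  then show ?case
    using g_radical_supplement_of_sum[OF C(1) C(3)[OF reg] insert.prems(2)] by blast
qed

lemma finitely_generated_g_radical_supplemented:
  assumes reg: "g_radical_supplemented R (regular_module R)" and fg: "finitely_generated R M"
  shows "g_radical_supplemented R M"
  unfolding g_radical_supplemented_def
proof (intro allI impI)
  fix U assume U: "submodule U R M"
  obtain S where S: "finite S" "S \<subseteq> carrier M" "generated_submodule R M S = carrier M"
    using fg by (auto simp: finitely_generated_def)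
  have "H = carrier M" if "submodule H R M" "S \<union> U \<subseteq> H" for H
    using that S(3) submodule_subset[OF that(1)] by (auto simp: generated_submodule_def)
  then show "\<exists>V. g_radical_supplement V U R M"
    by (rule ex_g_radical_supplement[OF reg S(1,2) U])
qed

end

section \<open>The regular module as a finitely generated module, and the equivalence\<close>

lemma (in ring) finitely_generated_regular_module: "finitely_generated R (regular_module R)"
proof -
  interpret reg: left_module R "regular_module R"
    by (rule left_module_regular_module)
  \<comment> \<open>Every a equals a times \<open>\<one>\<close>, so \<open>\<one>\<close> alone
    generates.\<close>
  have "a \<in> N" if N: "submodule N R (regular_module R)" "\<one> \<in> N" and "a \<in> carrier R" for N a
    using reg.submodule_smult[OF N(1) \<open>a \<in> carrier R\<close> N(2)] \<open>a \<in> carrier R\<close>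
    by (simp add: regular_module_def)
  then have "carrier R \<subseteq> generated_submodule R (regular_module R) {\<one>}"
    unfolding generated_submodule_def by blast
  moreover have "submodule (carrier R) R (regular_module R)"
    using reg.submodule_carrier by (simp add: regular_module_def)
  then have "generated_submodule R (regular_module R) {\<one>} \<subseteq> carrier R"
    unfolding generated_submodule_def by auto
  ultimately have "generated_submodule R (regular_module R) {\<one>} = carrier R"
    by blast
  then show ?thesis
    unfolding finitely_generated_def by (intro exI[of _ "{\<one>}"]) (simp add: regular_module_def)
qed

(* HOL cannot quantify over types inside a formula. The type 'm is free, so it ranges over all
   types; the second conjunct keeps the right-hand side from missing the regular module when 'm
   has fewer elements than R. *)

theorem corollary2p10:
  fixes R :: "('a, 'r) ring_scheme"
  assumes "ring R"
  shows "g_radical_supplemented R (regular_module R) \<longleftrightarrow>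
    (\<forall>M :: ('a, 'm) module.
      left_module R M \<and> finitely_generated R M \<longrightarrow> g_radical_supplemented R M) \<and>
    (\<forall>M :: ('a, 'a) module.
      left_module R M \<and> finitely_generated R M \<longrightarrow> g_radical_supplemented R M)"
proof (intro iffI conjI allI impI)
  show "g_radical_supplemented R M"
    if "g_radical_supplemented R (regular_module R)" "left_module R M \<and> finitely_generated R M"
    for M :: "('a, 'm) module"
    using that by (elim conjE) (rule left_module.finitely_generated_g_radical_supplemented)
  show "g_radical_supplemented R M"
    if "g_radical_supplemented R (regular_module R)" "left_module R M \<and> finitely_generated R M"
    for M :: "('a, 'a) module"
    using that by (elim conjE) (rule left_module.finitely_generated_g_radical_supplemented)
next
  assume "(\<forall>M :: ('a, 'm) module.
      left_module R M \<and> finitely_generated R M \<longrightarrow> g_radical_supplemented R M) \<and>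
    (\<forall>M :: ('a, 'a) module.
      left_module R M \<and> finitely_generated R M \<longrightarrow> g_radical_supplemented R M)"
  then show "g_radical_supplemented R (regular_module R)"
    using ring.left_module_regular_module[OF assms] ring.finitely_generated_regular_module[OF assms]
    by simp
qed

end
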